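(* Let $2\leq q<\infty$ and let $q^*:=q/(q-1)$. Then $$\frac{\pi_{q^*,q}^2-x^2}{\pi_{q^*,q}^2+x^2}<\left(\cos_{q^*,q}{\frac{x}{2}}\right)^{q^*-1}\quad\text{for all } x\in(0,\pi_{q^*,q}).$$
   Context: For $1<p,q<\infty$ define $F_{p,q}(x):=\int_0^x \frac{dt}{(1-t^q)^{1/p}}$ for $x\in[0,1]$, and $\pi_{p,q}:=2F_{p,q}(1)=2\int_0^1\frac{dt}{(1-t^q)^{1/p}}$, which is finite. The function $\sin_{p,q}:[0,\pi_{p,q}/2]\to[0,1]$ is the inverse function of the increasing bijection $F_{p,q}:[0,1]\to[0,\pi_{p,q}/2]$. It is extended to $(\pi_{p,q}/2,\pi_{p,q}]$ by $\sin_{p,q}{x}:=\sin_{p,q}(\pi_{p,q}-x)$, and then to all of $\mathbb{R}$ as the odd, $2\pi_{p,q}$-periodic continuation. The resulting function is $C^1$ on $\mathbb{R}$, and $\cos_{p,q}{x}:=\frac{d}{dx}\sin_{p,q}{x}$. In the claim these are used with first parameter $p=q^*$ and second parameter $q$. *)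

theory Defs
  imports "HOL-Analysis.Analysis"
begin

text \<open>
  All notions below are meant for \<open>1 < p\<close> and \<open>1 < q\<close>. The integrand is singular
  at \<open>t = 1\<close>, where HOL's totalised operations give it the value \<open>0\<close>; a single point
  does not affect the integral.
\<close>

definition F_pq :: "real \<Rightarrow> real \<Rightarrow> real \<Rightarrow> real" where
  "F_pq p q x = integral {0..x} (\<lambda>t. 1 / (1 - t powr q) powr (1 / p))"

definition pi_pq :: "real \<Rightarrow> real \<Rightarrow> real" where
  "pi_pq p q = 2 * F_pq p q 1"

text \<open>The generalized sine on \<open>[0, \<pi>\<^sub>p\<^sub>q]\<close>: the inverse of \<open>F_pq\<close> on the
  first half, reflected at \<open>\<pi>\<^sub>p\<^sub>q / 2\<close> on the second half.\<close>

definition sin_pq_arch :: "real \<Rightarrow> real \<Rightarrow> real \<Rightarrow> real" where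
  "sin_pq_arch p q x =
     (if x \<le> pi_pq p q / 2 then the_inv_into {0..1} (F_pq p q) x
      else the_inv_into {0..1} (F_pq p q) (pi_pq p q - x))"

text \<open>The odd, \<open>2 \<pi>\<^sub>p\<^sub>q\<close>-periodic continuation: \<open>x\<close> is first translated by a
  multiple of \<open>2 \<pi>\<^sub>p\<^sub>q\<close> to \<open>y \<in> [-\<pi>\<^sub>p\<^sub>q, \<pi>\<^sub>p\<^sub>q)\<close>.\<close>

definition sin_pq :: "real \<Rightarrow> real \<Rightarrow> real \<Rightarrow> real" where
  "sin_pq p q x =
     (let y = x - 2 * pi_pq p q * of_int \<lfloor>(x + pi_pq p q) / (2 * pi_pq p q)\<rfloor>
      in if 0 \<le> y then sin_pq_arch p q y else - sin_pq_arch p q (- y))"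

definition cos_pq :: "real \<Rightarrow> real \<Rightarrow> real \<Rightarrow> real" where
  "cos_pq p q = deriv (sin_pq p q)"

end

theory Submission
  imports Defs
begin

text \<open>
  Let \<open>q\<^sup>*\<close> be the exponent conjugate to \<open>q\<close>. For these parameters
  \<open>s = sin u\<close> and \<open>c = (cos u) powr (q\<^sup>* - 1)\<close> satisfy \<open>s powr q + c powr q = 1\<close>, and the
  point \<open>(s, c)\<close> traverses a quarter of this superellipse while \<open>u\<close>, which is twice the
  area that has been swept out, runs from \<open>0\<close> to \<open>P = F 1\<close>, half the generalized \<open>\<pi>\<close>.
  Putting \<open>u = x / 2\<close> and \<open>u = F s\<close>, the claim becomes
  \<open>(P\<^sup>2 - u\<^sup>2) / (P\<^sup>2 + u\<^sup>2) < c\<close>, a statement about the integral \<open>F\<close> alone. It is natural to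
  split the arc at the point \<open>(a, a)\<close> where it meets the diagonal (\<open>a = diag\<close>). The reflection
  that exchanges the coordinates gives \<open>F s + F c = P\<close> (\<open>F_symmetry\<close>), so this point is reached
  at \<open>u = P / 2\<close>.
  
  Beyond the diagonal, \<open>F\<close> is convex and \<open>F c = P - u\<close>, so comparison with the chord of \<open>F\<close> over
  \<open>[0, a]\<close> (\<open>F_le_chord\<close>) yields \<open>c \<ge> 2 * a * (1 - u / P)\<close>. Since \<open>q \<ge> 2\<close> makes \<open>a\<close> larger than
  \<open>7 / 10\<close>, this exceeds the quotient.
  
  Before the diagonal, \<open>c\<close> stays close to \<open>1\<close>: integrating \<open>s \<le> u\<close> gives
  \<open>1 - c \<le> u powr q / q\<close> (\<open>one_minus_ordinate_le\<close>). The quotient falls short of \<open>1\<close> by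
  \<open>2 * u\<^sup>2 / (P\<^sup>2 + u\<^sup>2)\<close>, which is at least \<open>8 / 5 * (u / P)\<^sup>2\<close> because \<open>u \<le> P / 2\<close>. It thus suffices
  that \<open>P\<^sup>2 < 8 / 5 * q\<close>. For large \<open>q\<close> the bound \<open>P < 2\<close> is enough. For \<open>q\<close> near \<open>2\<close>
  a sharper one is needed; it comes from cutting off the corner of the unit square along the
  tangent to the superellipse at \<open>(a, a)\<close> (\<open>F_1_le\<close>).
\<close>

section \<open>The superellipse and its arc function\<close>

locale superellipse =
  fixes q :: real
  assumes q_gt_1: "1 < q"
begin

text \<open>
  For \<open>t = sin u\<close> this is \<open>(cos u) powr (q\<^sup>* - 1)\<close>.
\<close>

definition ordinate :: "real \<Rightarrow> real" where
  "ordinate t = (1 - t powr q) powr (1 / q)"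

definition weight :: "real \<Rightarrow> real" where
  "weight t = (1 - t powr q) powr (1 / q - 1)"

definition F :: "real \<Rightarrow> real" where
  "F t = integral {0..t} weight"

text \<open>
  Both coordinates of the point of the superellipse on the diagonal.
\<close>

definition diag :: real where
  "diag = (1 / 2) powr (1 / q)"

lemma F_pq_conjugate: "F_pq (q / (q - 1)) q = F"
proof -
  have "1 / (q / (q - 1)) = 1 - 1 / q"
    using q_gt_1 by (simp add: field_simps)
  then have "(\<lambda>t. 1 / (1 - t powr q) powr (1 / (q / (q - 1)))) = weight"
    by (simp add: fun_eq_iff weight_def powr_minus_divide [symmetric])
  then show ?thesis
    by (simp add: fun_eq_iff F_pq_def F_def)
qed

lemma powr_q_less_1: "0 \<le> t \<Longrightarrow> t < 1 \<Longrightarrow> t powr q < 1"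
  using q_gt_1 powr_less_mono2 [of q t 1] by simp

lemma powr_q_le_1: "0 \<le> t \<Longrightarrow> t \<le> 1 \<Longrightarrow> t powr q \<le> 1"
  using q_gt_1 powr_mono2 [of q t 1] by simp

lemma ordinate_powr: "0 \<le> t \<Longrightarrow> t \<le> 1 \<Longrightarrow> ordinate t powr q = 1 - t powr q"
  using q_gt_1 powr_q_le_1 by (simp add: ordinate_def powr_powr)

lemma ordinate_0 [simp]: "ordinate 0 = 1"
  by (simp add: ordinate_def)

lemma ordinate_1 [simp]: "ordinate 1 = 0"
  by (simp add: ordinate_def)

lemma ordinate_nonneg: "0 \<le> ordinate t"
  by (simp add: ordinate_def)

lemma ordinate_pos: "0 \<le> t \<Longrightarrow> t < 1 \<Longrightarrow> 0 < ordinate t"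
  using powr_q_less_1 [of t] by (simp add: ordinate_def)

lemma ordinate_less_1: "0 < t \<Longrightarrow> t < 1 \<Longrightarrow> ordinate t < 1"
  using q_gt_1 powr_q_less_1 [of t] powr_less_mono2 [of "1/q" "1 - t powr q" 1]
  by (simp add: ordinate_def)

lemma ordinate_antimono: "0 \<le> s \<Longrightarrow> s \<le> t \<Longrightarrow> t \<le> 1 \<Longrightarrow> ordinate t \<le> ordinate s"
  unfolding ordinate_def using q_gt_1 powr_q_le_1 [of t]
  by (intro powr_mono2) (auto intro: powr_mono2)

lemma weight_pos: "0 \<le> t \<Longrightarrow> t < 1 \<Longrightarrow> 0 < weight t"
  using powr_q_less_1 [of t] by (simp add: weight_def)

lemma weight_mono: "0 \<le> s \<Longrightarrow> s \<le> t \<Longrightarrow> t < 1 \<Longrightarrow> weight s \<le> weight t"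
  unfolding weight_def using q_gt_1 powr_q_less_1 [of t]
  by (intro powr_mono2') (auto intro: powr_mono2)

lemma weight_ge_1: "0 \<le> t \<Longrightarrow> t < 1 \<Longrightarrow> 1 \<le> weight t"
  using weight_mono [of 0 t] by (simp add: weight_def)

lemma ordinate_eq_weight: "0 \<le> t \<Longrightarrow> t < 1 \<Longrightarrow> ordinate t = weight t * (1 - t powr q)"
  using powr_q_less_1 [of t] powr_mult_base [of "1 - t powr q" "1 / q - 1"]
  by (simp add: ordinate_def weight_def mult.commute)

lemma weight_ordinate:
  assumes "0 < t" "t < 1"
  shows "weight (ordinate t) = t powr (1 - q)"
proof -
  have "weight (ordinate t) = (t powr q) powr (1 / q - 1)"
    using assms by (simp add: weight_def ordinate_powr)
  also have "\<dots> = t powr (1 - q)"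
    using q_gt_1 by (simp add: powr_powr algebra_simps)
  finally show ?thesis .
qed

lemma diag_pos: "0 < diag"
  by (simp add: diag_def)

lemma diag_powr: "diag powr q = 1 / 2"
  using q_gt_1 by (simp add: diag_def powr_powr)

lemma diag_less_1: "diag < 1"
  using q_gt_1 powr_less_mono2 [of "1/q" "1/2" 1] by (simp add: diag_def)

lemma ordinate_diag [simp]: "ordinate diag = diag"
  unfolding ordinate_def diag_powr by (simp add: diag_def)

lemma ordinate_has_derivative:
  assumes "0 < t" "t < 1"
  shows "(ordinate has_real_derivative - (t powr (q - 1) * weight t)) (at t)"
proof -
  have "((\<lambda>t. 1 - t powr q) has_real_derivative - (q * t powr (q - 1))) (at t)"
    using assms by (auto intro!: derivative_eq_intros)
  from DERIV_chain2 [OF has_real_derivative_powr this, of "1 / q"]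
  show ?thesis
    using assms powr_q_less_1 [of t] q_gt_1
    unfolding ordinate_def [abs_def] weight_def by (simp add: mult.commute)
qed

lemma ordinate_continuous: "continuous_on {0..1} ordinate"
  unfolding ordinate_def [abs_def] using q_gt_1 powr_q_le_1
  by (intro continuous_on_powr' continuous_intros) auto

lemma weight_continuous: "b < 1 \<Longrightarrow> continuous_on {0..b} weight"
  unfolding weight_def [abs_def] using q_gt_1 powr_q_less_1
  by (intro continuous_on_powr' continuous_intros ballI conjI impI) (auto, smt (verit))

lemma weight_integrable_below_1: "b < 1 \<Longrightarrow> weight integrable_on {0..b}"
  using weight_continuous by (rule integrable_continuous_interval)

lemma F_0 [simp]: "F 0 = 0"
  by (simp add: F_def)

lemma F_continuous_below_1: "b < 1 \<Longrightarrow> continuous_on {0..b} F"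
  unfolding F_def [abs_def]
  by (intro indefinite_integral_continuous_1 weight_integrable_below_1)

lemma F_has_derivative:
  assumes "0 < t" "t < 1"
  shows "(F has_real_derivative weight t) (at t)"
proof -
  let ?b = "(1 + t) / 2"
  have "(F has_real_derivative weight t) (at t within {0..?b})"
    unfolding F_def [abs_def]
    using assms by (intro integral_has_real_derivative weight_continuous) auto
  moreover have "t \<in> interior {0..?b}"
    using assms by simp
  ultimately show ?thesis
    by (simp only: at_within_interior [of t "{0..?b}"])
qed

section \<open>Symmetry\<close>

text \<open>
  The reflection in the diagonal reverses the arc and preserves its parameter up to sign:
  the factor \<open>t powr (q - 1)\<close> from the chain rule cancels against \<open>weight (ordinate t)\<close>.
\<close>

lemma F_ordinate_has_derivative:
  assumes "0 < t" "t < 1"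
  shows "((\<lambda>t. F (ordinate t)) has_real_derivative - weight t) (at t)"
proof -
  have "((\<lambda>t. F (ordinate t)) has_real_derivative weight (ordinate t) * - (t powr (q - 1) * weight t)) (at t)"
    using assms ordinate_pos ordinate_less_1
    by (intro DERIV_chain2 [OF F_has_derivative ordinate_has_derivative]) auto
  moreover have "weight (ordinate t) * t powr (q - 1) = 1"
    using assms by (simp add: weight_ordinate powr_add [symmetric])
  ultimately show ?thesis
    by (simp add: mult.assoc [symmetric])
qed

lemma F_symmetry:
  assumes "0 < t" "t < 1"
  shows "F t + F (ordinate t) = 2 * F diag"
proof -
  have "((\<lambda>t. F t + F (ordinate t)) has_real_derivative 0) (at t within {0<..<1})"
    if "t \<in> {0<..<1}" for t
  proof -
    have "((\<lambda>t. F t + F (ordinate t)) has_real_derivative weight t + - weight t) (at t)"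
      using that by (intro DERIV_add F_has_derivative F_ordinate_has_derivative) auto
    then show ?thesis
      by (simp add: has_field_derivative_at_within)
  qed
  then obtain c where "\<And>t. t \<in> {0<..<1} \<Longrightarrow> F t + F (ordinate t) = c"
    using has_field_derivative_zero_constant [of "{0<..<1}" "\<lambda>t. F t + F (ordinate t)"] by auto
  from this [of t] this [of diag] show ?thesis
    using assms diag_pos diag_less_1 by simp
qed

text \<open>
  The integrand is unbounded near \<open>1\<close>. On \<open>[diag, 1]\<close>, however, the reflected function
  \<open>- F (ordinate t)\<close> is an antiderivative that is continuous up to the end point, since it
  only uses values of \<open>F\<close> on \<open>[0, diag]\<close>. So the fundamental theorem of calculus yields both
  integrability and the value.
\<close>

lemma weight_has_integral_upper: "(weight has_integral F diag) {diag..1}"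
proof -
  let ?H = "\<lambda>t. - F (ordinate t)"
  have "continuous_on {diag..1} ?H"
  proof (intro continuous_intros continuous_on_compose2 [OF F_continuous_below_1 [OF diag_less_1]])
    show "continuous_on {diag..1} ordinate"
      using diag_pos by (intro continuous_on_subset [OF ordinate_continuous]) auto
    show "ordinate ` {diag..1} \<subseteq> {0..diag}"
      using ordinate_antimono [of diag] ordinate_nonneg diag_pos by auto
  qed
  moreover have "(?H has_vector_derivative weight t) (at t)" if "t \<in> {diag<..<1}" for t
    using DERIV_minus [OF F_ordinate_has_derivative [of t]] that diag_pos
    by (simp add: has_real_derivative_iff_has_vector_derivative [symmetric])
  ultimately have "(weight has_integral (?H 1 - ?H diag)) {diag..1}"
    using diag_less_1 by (intro fundamental_theorem_of_calculus_interior) auto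
  then show ?thesis
    by simp
qed

lemma weight_has_integral: "(weight has_integral 2 * F diag) {0..1}"
proof -
  have "(weight has_integral F diag) {0..diag}"
    unfolding F_def by (rule integrable_integral [OF weight_integrable_below_1 [OF diag_less_1]])
  then have "(weight has_integral (F diag + F diag)) {0..1}"
    using diag_pos diag_less_1 weight_has_integral_upper by (intro has_integral_combine [of 0 diag 1]) auto
  then show ?thesis
    by (simp only: mult_2)
qed

lemma F_1: "F 1 = 2 * F diag"
  unfolding F_def [of 1] by (rule integral_unique [OF weight_has_integral])

lemma F_continuous: "continuous_on {0..1} F"
  unfolding F_def [abs_def]
  by (rule indefinite_integral_continuous_1 [OF has_integral_integrable [OF weight_has_integral]])

lemma F_strict_mono:
  assumes "0 \<le> s" "s < t" "t \<le> 1"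
  shows "F s < F t"
proof (rule DERIV_pos_imp_increasing_open [OF \<open>s < t\<close>])
  show "\<exists>d. (F has_real_derivative d) (at x) \<and> 0 < d" if "s < x" "x < t" for x
    using that assms F_has_derivative [of x] weight_pos [of x] by auto
  show "continuous_on {s..t} F"
    using assms by (intro continuous_on_subset [OF F_continuous]) auto
qed

lemma F_mono: "0 \<le> s \<Longrightarrow> s \<le> t \<Longrightarrow> t \<le> 1 \<Longrightarrow> F s \<le> F t"
  using F_strict_mono [of s t] by (cases "s = t") auto

lemma F_inj: "inj_on F {0..1}"
  by (intro linorder_inj_onI) (use F_strict_mono in force)+

section \<open>The generalized sine and cosine\<close>

lemma pi_pq_conjugate: "pi_pq (q / (q - 1)) q = 2 * F 1"
  by (simp add: pi_pq_def F_pq_conjugate)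

text \<open>
  On \<open>(0, F 1)\<close> neither the periodic continuation nor the reflection of the arch is active.
\<close>

lemma sin_pq_F:
  assumes "0 < t" "t < 1"
  shows "sin_pq (q / (q - 1)) q (F t) = t"
proof -
  have F: "0 < F t" "F t < F 1"
    using F_strict_mono [of 0 t] F_strict_mono [of t 1] assms by auto
  then have "\<lfloor>(F t + 2 * F 1) / (2 * (2 * F 1))\<rfloor> = 0"
    by (intro floor_unique) (auto simp: field_simps)
  then show ?thesis
    using F F_inj assms
    by (simp add: sin_pq_def sin_pq_arch_def pi_pq_conjugate F_pq_conjugate the_inv_into_f_f)
qed

lemma cos_pq_F:
  assumes "0 < t" "t < 1"
  shows "cos_pq (q / (q - 1)) q (F t) = inverse (weight t)"
proof -
  have "(sin_pq (q / (q - 1)) q has_derivative (\<lambda>h. inverse (weight t) * h)) (at (F t))"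
  proof (rule has_derivative_inverse_strong
      [where f = F and x = t and S = "{0<..<1}" and f' = "\<lambda>h. weight t * h"])
    show "(F has_derivative (\<lambda>h. weight t * h)) (at t)"
      using F_has_derivative [OF assms] by (simp add: has_field_derivative_def)
    show "continuous_on {0<..<1} F"
      by (rule continuous_on_subset [OF F_continuous]) auto
  qed (use assms weight_pos [of t] sin_pq_F in \<open>auto simp: fun_eq_iff\<close>)
  then have "(sin_pq (q / (q - 1)) q has_real_derivative inverse (weight t)) (at (F t))"
    by (simp add: has_field_derivative_def)
  then show ?thesis
    by (simp add: cos_pq_def DERIV_imp_deriv)
qed

text \<open>
  With the conjugate exponent the two powers combine to \<open>1 / q\<close>, which turns the power of
  the cosine into the second coordinate on the superellipse.
\<close>

lemma cos_pq_F_powr: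
  assumes "0 < t" "t < 1"
  shows "cos_pq (q / (q - 1)) q (F t) powr (q / (q - 1) - 1) = ordinate t"
proof -
  have "inverse (weight t) = (1 - t powr q) powr (1 - 1 / q)"
    using powr_minus [of "1 - t powr q" "1 / q - 1"] by (simp add: weight_def)
  then have "cos_pq (q / (q - 1)) q (F t) powr (q / (q - 1) - 1)
      = (1 - t powr q) powr ((1 - 1 / q) * (q / (q - 1) - 1))"
    using assms by (simp add: cos_pq_F powr_powr)
  also have "(1 - 1 / q) * (q / (q - 1) - 1) = 1 / q"
    using q_gt_1 by (simp add: field_simps)
  finally show ?thesis
    by (simp add: ordinate_def)
qed

section \<open>Estimates\<close>

lemma F_ge: 
  assumes "0 \<le> t" "t < 1"
  shows "t \<le> F t"
proof -
  have "F 0 - 0 \<le> F t - t"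
  proof (rule DERIV_nonneg_imp_increasing_open [where f = "\<lambda>t. F t - t"])
    show "\<exists>d. ((\<lambda>t. F t - t) has_real_derivative d) (at x) \<and> 0 \<le> d" if "0 < x" "x < t" for x
      using that assms weight_ge_1 [of x]
      by (intro exI [of _ "weight x - 1"]) (auto intro!: derivative_eq_intros F_has_derivative)
    show "continuous_on {0..t} (\<lambda>t. F t - t)"
      using assms by (intro continuous_intros F_continuous_below_1)
  qed (use assms in auto)
  then show ?thesis
    by simp
qed

text \<open>
  In the variable \<open>u = F t\<close> the ordinate has derivative \<open>- t powr (q - 1)\<close>, and \<open>t \<le> u\<close>.
\<close>

lemma one_minus_ordinate_le:
  assumes "0 \<le> t" "t < 1"
  shows "1 - ordinate t \<le> F t powr q / q"
proof -
  have "F 0 powr q / q + ordinate 0 \<le> F t powr q / q + ordinate t"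
  proof (rule DERIV_nonneg_imp_increasing_open [where f = "\<lambda>t. F t powr q / q + ordinate t"])
    fix x assume x: "0 < x" "x < t"
    then have le: "x \<le> F x"
      using F_ge [of x] assms by simp
    have "((\<lambda>t. F t powr q) has_real_derivative q * F x powr (q - 1) * weight x) (at x)"
      using x le assms
      by (intro DERIV_chain2 [OF has_real_derivative_powr F_has_derivative]) auto
    from DERIV_add [OF DERIV_cdivide [OF this, of q] ordinate_has_derivative [of x]]
    have "((\<lambda>t. F t powr q / q + ordinate t) has_real_derivative
        (F x powr (q - 1) - x powr (q - 1)) * weight x) (at x)"
      using x assms q_gt_1 by (simp add: algebra_simps)
    moreover have "x powr (q - 1) \<le> F x powr (q - 1)"
      using x le q_gt_1 by (intro powr_mono2) auto
    ultimately show "\<exists>d. ((\<lambda>t. F t powr q / q + ordinate t) has_real_derivative d) (at x) \<and> 0 \<le> d"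
      using weight_pos [of x] x assms by (intro exI conjI) auto
  next
    have "\<forall>x\<in>{0..t}. 0 \<le> F x \<and> (F x = 0 \<longrightarrow> 0 < q)"
      using assms q_gt_1 F_ge by force
    then have "continuous_on {0..t} (\<lambda>t. F t powr q)"
      using assms by (intro continuous_on_powr' F_continuous_below_1 continuous_on_const)
    moreover have "continuous_on {0..t} ordinate"
      using assms by (intro continuous_on_subset [OF ordinate_continuous]) auto
    ultimately show "continuous_on {0..t} (\<lambda>t. F t powr q / q + ordinate t)"
      using q_gt_1 by (intro continuous_on_add continuous_on_divide continuous_on_const) auto
  qed (use assms in auto)
  then show ?thesis
    using q_gt_1 by simp
qed

text \<open>
  \<open>F\<close> vanishes at \<open>0\<close> and is convex because the integrand is increasing. Convexity enters
  through the mean slopes to the left and to the right of \<open>c\<close>.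
\<close>

lemma F_le_chord:
  assumes "0 < c" "c \<le> diag"
  shows "F c * diag \<le> c * F diag"
proof (cases "c = diag")
  case False
  with assms have "c < diag" by simp
  have slope: "\<exists>z. s < z \<and> z < t \<and> F t - F s = (t - s) * weight z"
    if "0 \<le> s" "s < t" "t < 1" for s t
  proof -
    have "\<exists>l z. s < z \<and> z < t \<and> (F has_real_derivative l) (at z) \<and> F t - F s = (t - s) * l"
    proof (rule MVT [OF \<open>s < t\<close>])
      show "continuous_on {s..t} F"
        using that by (intro continuous_on_subset [OF F_continuous]) auto
      show "F differentiable at x" if "s < x" "x < t" for x
        unfolding real_differentiable_def
        using that \<open>0 \<le> s\<close> \<open>t < 1\<close> by (intro exI [of _ "weight x"] F_has_derivative) auto
    qed
    then obtain l z where z: "s < z" "z < t" "(F has_real_derivative l) (at z)"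
      "F t - F s = (t - s) * l"
      by blast
    moreover have "l = weight z"
      using z that DERIV_unique [OF z(3) F_has_derivative] by auto
    ultimately show ?thesis
      by blast
  qed
  obtain z1 where z1: "0 < z1" "z1 < c" "F c = c * weight z1"
    using slope [of 0 c] assms diag_less_1 by auto
  obtain z2 where z2: "c < z2" "z2 < diag" "F diag - F c = (diag - c) * weight z2"
    using slope [of c diag] assms \<open>c < diag\<close> diag_less_1 by auto
  have "weight z1 \<le> weight z2"
    using z1 z2 diag_less_1 by (intro weight_mono) auto
  then have "c * (diag - c) * weight z1 \<le> c * (diag - c) * weight z2"
    using assms by (intro mult_left_mono) auto
  moreover have "F c * (diag - c) = c * (diag - c) * weight z1"
    using z1(3) by simp
  moreover have "c * (F diag - F c) = c * (diag - c) * weight z2"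
    using z2(3) by simp
  ultimately have "F c * (diag - c) \<le> c * (F diag - F c)"
    by linarith
  then show ?thesis
    by (simp add: algebra_simps)
qed simp

text \<open>
  The superellipse lies below its tangent at the diagonal point; equivalently, this is the
  inequality between the arithmetic mean and the power mean of order \<open>q\<close>.
\<close>

lemma add_ordinate_le:
  assumes "0 < t" "t < 1"
  shows "t + ordinate t \<le> 2 * diag"
proof -
  have "((1 - 1 / 2) * t + 1 / 2 * ordinate t) powr q
      \<le> (1 - 1 / 2) * t powr q + 1 / 2 * ordinate t powr q"
    using convex_onD [OF powr_convex, of q "1 / 2" t "ordinate t"] assms ordinate_pos q_gt_1 by simp
  also have "\<dots> = diag powr q"
    using assms by (simp add: ordinate_powr diag_powr diff_divide_distrib)
  finally have "((t + ordinate t) / 2) powr q \<le> diag powr q"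
    by (simp add: add_divide_distrib)
  then have "(t + ordinate t) / 2 \<le> diag"
    using powr_less_mono2 [of q diag "(t + ordinate t) / 2"] q_gt_1 diag_pos by linarith
  then show ?thesis
    by simp
qed

text \<open>
  Twice the area of the unit square without the triangle that the tangent at
  \<open>(diag, diag)\<close> cuts off its corner. The bound is proved up to the diagonal and doubled by
  symmetry. Write \<open>c\<close> for \<open>ordinate t\<close>. Then \<open>F t\<close> is \<open>t * c\<close> plus twice the
  integral, over \<open>[c, 1]\<close>, of the first coordinate as a function of the second one. The
  expression subtracted in \<open>B\<close> arises when the first coordinate is replaced by its upper
  bound, \<open>2 * diag\<close> minus the second coordinate (\<open>add_ordinate_le\<close>). So the
  derivative of \<open>B\<close> is a nonnegative multiple of \<open>t + ordinate t - 2 * diag\<close>.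
\<close>

lemma F_1_le: "F 1 \<le> 2 - 4 * (1 - diag)\<^sup>2"
proof -
  define B where "B t = F t - (t * ordinate t + 4 * diag * (1 - ordinate t) - (1 - (ordinate t)\<^sup>2))" for t
  have "B diag \<le> B 0"
  proof (rule DERIV_nonpos_imp_decreasing_open [where f = B])
    fix x assume "0 < x" "x < diag"
    then have x: "0 < x" "x < 1"
      using diag_less_1 by auto
    have "x powr q = x * x powr (q - 1)"
      using x powr_mult_base [of x "q - 1"] by simp
    then have weight_diff: "weight x - ordinate x = x * (x powr (q - 1) * weight x)"
      using ordinate_eq_weight [of x] x by (simp add: algebra_simps)
    let ?d = "- (x powr (q - 1) * weight x)"
    have "(B has_real_derivative
        weight x - (ordinate x + x * ?d - 4 * diag * ?d + 2 * ordinate x * ?d)) (at x)"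
      unfolding B_def [abs_def]
      by (rule derivative_eq_intros F_has_derivative ordinate_has_derivative x refl | simp)+
    moreover have "weight x - (ordinate x + x * ?d - 4 * diag * ?d + 2 * ordinate x * ?d)
        = 2 * (x powr (q - 1) * weight x) * (x + ordinate x - 2 * diag)"
      using weight_diff by (simp add: algebra_simps)
    moreover have "\<dots> \<le> 0"
      using add_ordinate_le [OF x] weight_pos [of x] x by (intro mult_nonneg_nonpos) auto
    ultimately show "\<exists>d. (B has_real_derivative d) (at x) \<and> d \<le> 0"
      by auto
  next
    show "continuous_on {0..diag} B"
      unfolding B_def [abs_def] using diag_less_1
      by (intro continuous_intros F_continuous_below_1 continuous_on_subset [OF ordinate_continuous]) auto
  qed (use diag_pos in simp)
  then show ?thesis
    by (simp add: B_def F_1 power2_eq_square algebra_simps)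
qed

lemma F_1_less_2: "F 1 < 2"
  using F_1_le diag_less_1 by (smt (verit) zero_less_power2)

lemma F_1_pos: "0 < F 1"
  using F_strict_mono [of 0 1] by simp

end

locale flat_superellipse = superellipse +
  assumes q_ge_2: "2 \<le> q"
begin

lemma diag_ge: "7 / 10 \<le> diag"
proof (rule ccontr)
  assume "\<not> 7 / 10 \<le> diag"
  then have "diag powr q \<le> (7 / 10) powr q"
    using diag_pos q_ge_2 by (intro powr_mono2) auto
  also have "\<dots> \<le> (7 / 10) powr 2"
    using q_ge_2 by (intro powr_mono') auto
  finally show False
    by (simp add: diag_powr power2_eq_square)
qed

lemma diag_le:
  assumes "q \<le> 5 / 2"
  shows "diag \<le> 19 / 25"
proof (rule ccontr)
  assume "\<not> diag \<le> 19 / 25"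
  then have "(19 / 25) powr 5 \<le> diag powr 5"
    by (intro powr_mono2) auto
  also have "\<dots> \<le> diag powr (2 * q)"
    using assms diag_pos diag_less_1 by (intro powr_mono') auto
  also have "\<dots> = (diag powr q)\<^sup>2"
    using diag_pos by (simp add: powr_powr [symmetric] mult.commute)
  finally show False
    by (simp add: diag_powr power_divide)
qed

text \<open>
  As \<open>F 1 < 2\<close> gives \<open>u \<le> 1\<close>, the power is at most \<open>u\<^sup>2\<close>, and only \<open>(F 1)\<^sup>2 < 8 / 5 * q\<close> remains. The
  threshold \<open>5 / 2\<close> is the value of \<open>q\<close> from which on \<open>(F 1)\<^sup>2 < 4\<close> suffices; below it,
  \<open>diag \<le> 19 / 25\<close> pushes \<open>F 1\<close> down to \<open>177 / 100\<close>.
\<close>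

lemma F_powr_less:
  assumes "0 < u" "u \<le> F 1 / 2"
  shows "u powr q / q * (F 1)\<^sup>2 < 8 / 5 * u\<^sup>2"
proof -
  have "u powr q \<le> u powr 2"
    using assms q_ge_2 F_1_less_2 by (intro powr_mono') auto
  then have u: "u powr q \<le> u\<^sup>2"
    using assms by simp
  have "(F 1)\<^sup>2 < 8 / 5 * q"
  proof (cases "q \<le> 5 / 2")
    case True
    have "(6 / 25)\<^sup>2 \<le> (1 - diag)\<^sup>2"
      using diag_le [OF True] by (intro power_mono) auto
    then have "F 1 \<le> 177 / 100"
      using F_1_le by (simp add: power2_eq_square)
    then have "(F 1)\<^sup>2 \<le> (177 / 100)\<^sup>2"
      using F_1_pos by (intro power_mono) auto
    then show ?thesis
      using q_ge_2 by (simp add: power2_eq_square)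
  next
    case False
    have "(F 1)\<^sup>2 < 2\<^sup>2"
      using F_1_less_2 F_1_pos by (intro power_strict_mono) auto
    then show ?thesis
      using False by simp
  qed
  then have "u\<^sup>2 * (F 1)\<^sup>2 < u\<^sup>2 * (8 / 5 * q)"
    using assms by simp
  moreover have "u powr q * (F 1)\<^sup>2 \<le> u\<^sup>2 * (F 1)\<^sup>2"
    using u by (intro mult_right_mono) auto
  ultimately show ?thesis
    using q_ge_2 by (simp add: field_simps)
qed

lemma redheffer_below_diag:
  assumes "0 < t" "t \<le> diag"
  shows "((F 1)\<^sup>2 - (F t)\<^sup>2) / ((F 1)\<^sup>2 + (F t)\<^sup>2) < ordinate t"
proof -
  let ?P = "F 1" and ?u = "F t"
  have u: "0 < ?u" "?u \<le> ?P / 2"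
    using assms F_strict_mono [of 0 t] F_mono [of t diag] diag_less_1 by (auto simp: F_1)
  have "?u\<^sup>2 \<le> (?P / 2)\<^sup>2"
    using u by (intro power_mono) auto
  then have "?P\<^sup>2 + ?u\<^sup>2 \<le> 5 / 4 * ?P\<^sup>2"
    by (simp add: power2_eq_square)
  have "?u powr q / q < 8 / 5 * ?u\<^sup>2 / ?P\<^sup>2"
    unfolding pos_less_divide_eq [OF zero_less_power [OF F_1_pos]] by (rule F_powr_less [OF u])
  also have "\<dots> = 2 * ?u\<^sup>2 / (5 / 4 * ?P\<^sup>2)"
    by simp
  also have "\<dots> \<le> 2 * ?u\<^sup>2 / (?P\<^sup>2 + ?u\<^sup>2)"
    using \<open>?P\<^sup>2 + ?u\<^sup>2 \<le> 5 / 4 * ?P\<^sup>2\<close> F_1_pos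
    by (intro divide_left_mono) (auto intro!: mult_pos_pos add_pos_nonneg)
  finally have "1 - ordinate t < 2 * ?u\<^sup>2 / (?P\<^sup>2 + ?u\<^sup>2)"
    using one_minus_ordinate_le [of t] assms diag_less_1 by simp
  moreover have "(?P\<^sup>2 - ?u\<^sup>2) / (?P\<^sup>2 + ?u\<^sup>2) = 1 - 2 * ?u\<^sup>2 / (?P\<^sup>2 + ?u\<^sup>2)"
  proof -
    have "?P\<^sup>2 + ?u\<^sup>2 \<noteq> 0"
      using F_1_pos by (simp add: sum_power2_eq_zero_iff)
    then show ?thesis
      by (simp add: field_simps)
  qed
  ultimately show ?thesis
    by simp
qed

lemma redheffer_above_diag:
  assumes "diag \<le> t" "t < 1"
  shows "((F 1)\<^sup>2 - (F t)\<^sup>2) / ((F 1)\<^sup>2 + (F t)\<^sup>2) < ordinate t"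
proof -
  let ?P = "F 1" and ?u = "F t"
  have c: "0 < ordinate t" "ordinate t \<le> diag"
    using assms ordinate_pos [of t] ordinate_antimono [of diag t] diag_pos by auto
  define r where "r = ?u / ?P"
  have u: "?u < ?P" "0 < ?u"
    using F_strict_mono [of t 1] F_strict_mono [of 0 t] assms diag_pos by auto
  then have r: "0 < r" "r < 1" "?u = r * ?P"
    using F_1_pos by (auto simp: r_def)
  have "F (ordinate t) = ?P - ?u"
    using F_symmetry [of t] assms diag_pos by (simp add: F_1)
  also have "\<dots> = ?P * (1 - r)"
    by (simp add: r(3) algebra_simps)
  finally have "?P * (1 - r) * diag \<le> ordinate t * (?P / 2)"
    using F_le_chord [OF c] by (simp add: F_1)
  then have "?P * (2 * diag * (1 - r)) \<le> ?P * ordinate t"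
    by (simp add: algebra_simps)
  then have chord: "2 * diag * (1 - r) \<le> ordinate t"
    using F_1_pos by simp
  have "(?P\<^sup>2 - ?u\<^sup>2) / (?P\<^sup>2 + ?u\<^sup>2) = (1 - r\<^sup>2) / (1 + r\<^sup>2)"
  proof -
    have "?P\<^sup>2 - ?u\<^sup>2 = ?P\<^sup>2 * (1 - r\<^sup>2)" "?P\<^sup>2 + ?u\<^sup>2 = ?P\<^sup>2 * (1 + r\<^sup>2)"
      unfolding r(3) by (simp_all add: power_mult_distrib algebra_simps)
    then show ?thesis
      using F_1_pos by simp
  qed
  also have "\<dots> < 7 / 5 * (1 - r)"
  proof -
    \<comment> \<open>This is the difference of the two sides of the next inequality, with the square completed.\<close>
    have "0 < 7 / 5 * (r - 5 / 14)\<^sup>2 + 31 / 140"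
      by (simp add: add_nonneg_pos)
    then have "1 + r < 7 / 5 * (1 + r\<^sup>2)"
      by (simp add: power2_eq_square field_simps)
    then have "(1 - r) * (1 + r) < (1 - r) * (7 / 5 * (1 + r\<^sup>2))"
      using r by simp
    then have "1 - r\<^sup>2 < 7 / 5 * (1 - r) * (1 + r\<^sup>2)"
      by (simp add: power2_eq_square algebra_simps)
    moreover have "0 < 1 + r\<^sup>2"
      by (simp add: add_pos_nonneg)
    ultimately show ?thesis
      by (simp add: pos_divide_less_eq)
  qed
  also have "\<dots> \<le> 2 * diag * (1 - r)"
    using diag_ge r by (intro mult_right_mono) auto
  finally show ?thesis
    using chord by simp
qed

end

theorem corollary1p3:
  fixes q qs :: real
  assumes "2 \<le> q"
    and "qs = q / (q - 1)"
  shows "\<forall>x\<in>{0<..<pi_pq qs q}.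
    ((pi_pq qs q)\<^sup>2 - x\<^sup>2) / ((pi_pq qs q)\<^sup>2 + x\<^sup>2) < (cos_pq qs q (x / 2)) powr (qs - 1)"
proof
  interpret flat_superellipse q
    using assms by unfold_locales auto
  fix x assume "x \<in> {0<..<pi_pq qs q}"
  then have x: "0 < x / 2" "x / 2 < F 1"
    by (auto simp: assms(2) pi_pq_conjugate)
  then obtain t where t: "0 \<le> t" "t \<le> 1" "F t = x / 2"
    using IVT' [of F 0 "x / 2" 1] F_continuous by auto
  then have t': "0 < t" "t < 1"
    using x by (auto simp: less_le)
  have "pi_pq qs q = 2 * F 1" "x = 2 * F t"
    using t by (simp_all add: assms(2) pi_pq_conjugate)
  then have "(pi_pq qs q)\<^sup>2 - x\<^sup>2 = 4 * ((F 1)\<^sup>2 - (F t)\<^sup>2)"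
    "(pi_pq qs q)\<^sup>2 + x\<^sup>2 = 4 * ((F 1)\<^sup>2 + (F t)\<^sup>2)"
    by (simp_all add: power2_eq_square)
  then have "((pi_pq qs q)\<^sup>2 - x\<^sup>2) / ((pi_pq qs q)\<^sup>2 + x\<^sup>2)
      = ((F 1)\<^sup>2 - (F t)\<^sup>2) / ((F 1)\<^sup>2 + (F t)\<^sup>2)"
    by (simp only: mult_divide_mult_cancel_left_if) simp
  also have "\<dots> < ordinate t"
    using redheffer_below_diag redheffer_above_diag t' by (cases "t \<le> diag") auto
  also have "\<dots> = (cos_pq qs q (x / 2)) powr (qs - 1)"
    using cos_pq_F_powr [OF t'] t by (simp add: assms(2))
  finally show "((pi_pq qs q)\<^sup>2 - x\<^sup>2) / ((pi_pq qs q)\<^sup>2 + x\<^sup>2) < (cos_pq qs q (x / 2)) powr (qs - 1)" .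
qed

end
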